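(* Let $\Gamma$ be a smooth closed convex plane bicycle curve. Then $\Gamma$ has at least $6$ vertices.
   Context: A closed smooth convex plane curve $\Gamma$ of perimeter length $2\pi$ (the normalization used throughout), parameterized by arc length as $\Gamma:\mathbf{R}/2\pi\mathbf{Z}\to\mathbf{R}^2$, is a bicycle curve if for some $\rho\in(0,1)$ (its rotation number) the distance $|\Gamma(x+2\pi\rho)-\Gamma(x)|$ does not depend on $x$. A vertex of a smooth plane curve is a local maximum or local minimum (not necessarily strict) of its curvature. *)

theory Defs
  imports "HOL-Analysis.Analysis"
begin

definition vderiv :: "nat \<Rightarrow> (real \<Rightarrow> real^2) \<Rightarrow> real \<Rightarrow> real^2" where
  "vderiv n \<gamma> = ((\<lambda>f t. vector_derivative f (at t)) ^^ n) \<gamma>"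

definition smooth :: "(real \<Rightarrow> real^2) \<Rightarrow> bool" where
  "smooth \<gamma> \<longleftrightarrow> (\<forall>n t. vderiv n \<gamma> differentiable (at t))"

(* A map from R/2piZ is represented by its 2pi-periodic lift to the real line. *)
definition smooth_closed_arclength_curve :: "(real \<Rightarrow> real^2) \<Rightarrow> bool" where
  "smooth_closed_arclength_curve \<gamma> \<longleftrightarrow>
     smooth \<gamma> \<and> (\<forall>x. \<gamma> (x + 2 * pi) = \<gamma> x) \<and> (\<forall>x. norm (vderiv 1 \<gamma> x) = 1)"

(* A convex curve traverses the boundary of a compact convex region exactly once.
   Convexity is not required to be strict: the curvature may vanish. *)
definition convex_curve :: "(real \<Rightarrow> real^2) \<Rightarrow> bool" where
  "convex_curve \<gamma> \<longleftrightarrow>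
     inj_on \<gamma> {0..<2*pi} \<and> (\<exists>K. compact K \<and> convex K \<and> range \<gamma> = frontier K)"

definition bicycle_curve :: "(real \<Rightarrow> real^2) \<Rightarrow> bool" where
  "bicycle_curve \<gamma> \<longleftrightarrow>
     (\<exists>\<rho>::real. 0 < \<rho> \<and> \<rho> < 1 \<and> (\<exists>l. \<forall>x. dist (\<gamma> (x + 2 * pi * \<rho>)) (\<gamma> x) = l))"

(* Signed curvature det(\<gamma>', \<gamma>''); no normalizing denominator is needed because
   it is only used for curves parameterized by arc length. *)
definition curvature :: "(real \<Rightarrow> real^2) \<Rightarrow> real \<Rightarrow> real" where
  "curvature \<gamma> t =
     vderiv 1 \<gamma> t $ 1 * vderiv 2 \<gamma> t $ 2 - vderiv 1 \<gamma> t $ 2 * vderiv 2 \<gamma> t $ 1"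

definition is_vertex :: "(real \<Rightarrow> real^2) \<Rightarrow> real \<Rightarrow> bool" where
  "is_vertex \<gamma> t \<longleftrightarrow>
     (\<forall>\<^sub>F s in nhds t. curvature \<gamma> s \<le> curvature \<gamma> t) \<or>
     (\<forall>\<^sub>F s in nhds t. curvature \<gamma> s \<ge> curvature \<gamma> t)"

(* One parameter per point of R/2piZ, hence per point of the curve if it is simple. *)
definition vertices :: "(real \<Rightarrow> real^2) \<Rightarrow> real set" where
  "vertices \<gamma> = {t \<in> {0..<2*pi}. is_vertex \<gamma> t}"

end

theory Submission
  imports Defs
begin

text \<open>
  Let \<open>\<alpha>\<close> be the arc length cut off by the chords of constant length, \<open>\<theta>\<close> the tangent angle and
  \<open>k = \<theta>'\<close> the curvature. Differentiating the chord condition shows that for every \<open>t\<close> some circle is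
  tangent to the curve at both \<open>t\<close> and \<open>t + \<alpha>\<close>, and that its curvature \<open>c\<close> is the mean of the
  curvatures of the curve at these two points. Because of the double tangency, \<open>k - c\<close> is orthogonal
  to \<open>cos \<theta>\<close> and \<open>sin \<theta>\<close> on each of the two arcs between the points, so on an arc that turns by
  at most \<open>\<pi>\<close> it changes sign at least twice, as in Hurwitz' theorem, or vanishes.

  If some arc turns by exactly \<open>\<pi>\<close>, so does its complement, and the two sign patterns together give
  three maxima and three minima of \<open>k\<close>. Otherwise all arcs of length \<open>\<alpha>\<close>, or all
  complementary arcs, turn by less than \<open>\<pi>\<close>. Their common length is then less than \<open>\<pi>\<close>, and each of
  them contains a maximum and a minimum of \<open>k\<close> in its interior, because the values of \<open>k - c\<close> at its
  ends are opposite. Starting from a maximum, the arcs before and after it contain two more;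
  the same holds for minima.
\<close>

section \<open>Local extrema of periodic functions\<close>

definition wrap :: "real \<Rightarrow> real" where
  "wrap t = t - of_int \<lfloor>t / (2*pi)\<rfloor> * (2*pi)"

lemma wrap_range: "wrap t \<in> {0..<2*pi}"
proof -
  have a: "of_int \<lfloor>t / (2*pi)\<rfloor> \<le> t / (2*pi)" and b: "t / (2*pi) < of_int \<lfloor>t / (2*pi)\<rfloor> + 1"
    by linarith+
  have "of_int \<lfloor>t / (2*pi)\<rfloor> * (2*pi) \<le> t" by (rule iffD1[OF pos_le_divide_eq a]) simp
  moreover have "t < (of_int \<lfloor>t / (2*pi)\<rfloor> + 1) * (2*pi)" by (rule iffD1[OF pos_divide_less_eq b]) simp
  ultimately show ?thesis by (simp add: wrap_def algebra_simps)
qed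

lemma inj_on_wrap: "inj_on wrap {a..<a + 2*pi}"
proof (rule inj_onI)
  fix s t assume st: "s \<in> {a..<a + 2*pi}" "t \<in> {a..<a + 2*pi}" and eq: "wrap s = wrap t"
  define m where "m = \<lfloor>s / (2*pi)\<rfloor> - \<lfloor>t / (2*pi)\<rfloor>"
  have d: "s - t = of_int m * (2*pi)"
    using eq by (simp add: wrap_def m_def algebra_simps)
  have "\<bar>s - t\<bar> < 2*pi" using st by auto
  then have "\<bar>real_of_int m\<bar> * (2*pi) < 1 * (2*pi)" unfolding d by (simp add: abs_mult)
  then have "\<bar>real_of_int m\<bar> < 1" using mult_less_cancel_right_pos[of "2*pi"] by simp
  then have "m = 0" by linarith
  then show "s = t" using d by simp
qed

lemma periodic_wrap:
  assumes "\<And>t. f (t + 2*pi) = f t"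
  shows "f (wrap t) = f t"
proof -
  interpret periodic_fun_simple f "2*pi" by standard (rule assms)
  show ?thesis unfolding wrap_def by (rule minus_of_int)
qed

text \<open>Vertices are counted in [0, 2 pi), while extrema are found in a period window starting
  anywhere. \<open>wrap\<close> carries such a window injectively into [0, 2 pi).\<close>

lemma card_periodic_ge:
  assumes "\<And>t. P (t + 2*pi) = P t" and "S \<subseteq> {a..<a + 2*pi}" and "\<And>s. s \<in> S \<Longrightarrow> P s"
    and "finite {t \<in> {0..<2*pi}. P t}"
  shows "finite S" and "card S \<le> card {t \<in> {0..<2*pi}. P t}"
proof -
  have i: "inj_on wrap S" using inj_on_wrap assms(2) by (rule inj_on_subset)
  have s: "wrap ` S \<subseteq> {t \<in> {0..<2*pi}. P t}"
    using assms(3) wrap_range periodic_wrap[of P, OF assms(1)] by auto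
  show "finite S" using i s assms(4) by (meson finite_imageD finite_subset)
  show "card S \<le> card {t \<in> {0..<2*pi}. P t}" using i s assms(4) by (rule card_inj_on_le)
qed

text \<open>Minima are treated as local maxima of the negated function, so each fact about maxima
  serves both kinds.\<close>

definition local_max :: "(real \<Rightarrow> real) \<Rightarrow> real \<Rightarrow> bool" where
  "local_max g t \<longleftrightarrow> (\<forall>\<^sub>F s in nhds t. g s \<le> g t)"

abbreviation local_extr :: "(real \<Rightarrow> real) \<Rightarrow> real \<Rightarrow> bool" where
  "local_extr g t \<equiv> local_max g t \<or> local_max (\<lambda>s. - g s) t"

lemma local_max_periodic:
  assumes "\<And>t. g (t + 2*pi) = g t"
  shows "local_max g (t + 2*pi) = local_max g t"
proof -
  have "local_max g (t + 2*pi) \<longleftrightarrow> (\<forall>\<^sub>F s in filtermap (\<lambda>s. s - - (2*pi)) (nhds t). g s \<le> g t)"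
    unfolding local_max_def filtermap_nhds_shift by (simp add: assms)
  also have "\<dots> \<longleftrightarrow> local_max g t"
    unfolding local_max_def eventually_filtermap by (simp add: assms)
  finally show ?thesis .
qed

lemma local_max_between:
  assumes c: "continuous_on UNIV g" and "a < b" "b < d" "g a < g b" "g d < g b"
  obtains t where "a < t" "t < d" "local_max g t"
proof -
  have "continuous_on {a..d} g" using c continuous_on_subset by blast
  then obtain t where t: "t \<in> {a..d}" "\<And>s. s \<in> {a..d} \<Longrightarrow> g s \<le> g t"
    using continuous_attains_sup[of "{a..d}" g] assms by auto
  have "g b \<le> g t" using t(2) assms by simp
  then have "t \<noteq> a" "t \<noteq> d" using assms by auto
  then have "a < t" "t < d" using t(1) by auto
  moreover have "local_max g t"
    unfolding local_max_def eventually_nhds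
    using calculation t(2) by (intro exI[of _ "{a<..<d}"]) auto
  ultimately show ?thesis using that by blast
qed

lemma infinite_local_extr_if_constant:
  assumes per: "\<And>t. g (t + 2*pi) = g t" and "p < q" and const: "\<And>t. p < t \<Longrightarrow> t < q \<Longrightarrow> g t = C"
  shows "infinite {t \<in> {0..<2*pi}. local_extr g t}"
proof
  assume fin: "finite {t \<in> {0..<2*pi}. local_extr g t}"
  \<comment> \<open>Cutting the interval at \<open>p + 2*pi\<close> keeps it inside one period
    window, so its points stay distinct modulo the period.\<close>
  define r where "r = min q (p + 2*pi)"
  have "p < r" using \<open>p < q\<close> pi_gt_zero by (simp add: r_def)
  have ext: "local_extr g s" if s: "s \<in> {p<..<r}" for s
  proof (rule disjI1, unfold local_max_def eventually_nhds, intro exI[of _ "{p<..<r}"] conjI ballI)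
    fix u assume "u \<in> {p<..<r}"
    then have "g u = C" "g s = C" using s const by (auto simp: r_def)
    then show "g u \<le> g s" by simp
  qed (use s in auto)
  have ext_periodic: "local_extr g (t + 2*pi) = local_extr g t" for t
    using local_max_periodic[of g] local_max_periodic[of "\<lambda>t. - g t"] per by simp
  have "{p<..<r} \<subseteq> {p..<p + 2*pi}" by (auto simp: r_def)
  then have "finite {p<..<r}"
    by (rule card_periodic_ge(1)[of "local_extr g", OF ext_periodic _ ext fin])
  then show False using \<open>p < r\<close> infinite_Ioo by blast
qed

text \<open>The two triples may lie in different windows and interleave arbitrarily. A point that is
  both a maximum and a minimum makes \<open>g\<close> constant nearby, which already gives
  infinitely many extrema; otherwise the counts 3 and 3 add up.\<close>

lemma six_local_extr:
  assumes per: "\<And>t. g (t + 2*pi) = g t"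
    and mx: "a0 < a1" "a1 < a2" "a2 < a0 + 2*pi" "local_max g a0" "local_max g a1" "local_max g a2"
    and mn: "b0 < b1" "b1 < b2" "b2 < b0 + 2*pi"
      "local_max (\<lambda>s. - g s) b0" "local_max (\<lambda>s. - g s) b1" "local_max (\<lambda>s. - g s) b2"
  shows "infinite {t \<in> {0..<2*pi}. local_extr g t} \<or> card {t \<in> {0..<2*pi}. local_extr g t} \<ge> 6"
proof (subst disj_imp, rule impI)
  assume "\<not> infinite {t \<in> {0..<2*pi}. local_extr g t}"
  then have fin: "finite {t \<in> {0..<2*pi}. local_extr g t}" by simp
  let ?M = "{t \<in> {0..<2*pi}. local_max g t}" and ?N = "{t \<in> {0..<2*pi}. local_max (\<lambda>s. - g s) t}"
  have un: "{t \<in> {0..<2*pi}. local_extr g t} = ?M \<union> ?N" by auto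
  have finM: "finite ?M" and finN: "finite ?N" using fin unfolding un by auto
  have "card {a0,a1,a2} \<le> card ?M"
    using mx finM local_max_periodic[of g, OF per]
    by (intro card_periodic_ge(2)[of "local_max g" _ a0]) auto
  moreover have "card {b0,b1,b2} \<le> card ?N"
    using mn finN local_max_periodic[of "\<lambda>s. - g s"] per
    by (intro card_periodic_ge(2)[of "local_max (\<lambda>s. - g s)" _ b0]) auto
  moreover have "card {a0,a1,a2} = 3" "card {b0,b1,b2} = 3" using mx mn by auto
  moreover have "?M \<inter> ?N = {}"
  proof (rule ccontr)
    assume "?M \<inter> ?N \<noteq> {}"
    then obtain t where "local_max g t" "local_max (\<lambda>s. - g s) t" by blast
    then have "\<forall>\<^sub>F s in nhds t. g s = g t"
      unfolding local_max_def by eventually_elim simp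
    then obtain e where "e > 0" and e: "\<And>s. dist s t < e \<Longrightarrow> g s = g t"
      unfolding eventually_nhds_metric by blast
    have "g s = g t" if "t < s" "s < t + e" for s
      by (rule e) (use that in \<open>simp add: dist_real_def\<close>)
    then have "infinite {t \<in> {0..<2*pi}. local_extr g t}"
      using infinite_local_extr_if_constant[of g t "t + e" "g t", OF per] \<open>e > 0\<close> by simp
    then show False using fin by blast
  qed
  ultimately show "card {t \<in> {0..<2*pi}. local_extr g t} \<ge> 6"
    unfolding un by (subst card_Un_disjoint) (use finM finN in auto)
qed

text \<open>Six samples that go up and down alternately around the circle: each lies strictly above
  or strictly below both neighbours, so there is an extremum of its kind between these
  neighbours.\<close>

lemma six_local_extr_if_zigzag:
  assumes per: "\<And>t. g (t + 2*pi) = g t" and c: "continuous_on UNIV g"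
    and "t0 < t1" "t1 < t2" "t2 < t3" "t3 < t4" "t4 < t5" "t5 < t0 + 2*pi"
    and "g t0 < g t1" "g t2 < g t1" "g t2 < g t3" "g t4 < g t3" "g t4 < g t5" "g t0 < g t5"
  shows "infinite {t \<in> {0..<2*pi}. local_extr g t} \<or> card {t \<in> {0..<2*pi}. local_extr g t} \<ge> 6"
proof -
  have c': "continuous_on UNIV (\<lambda>s. - g s)" using c by (intro continuous_intros)
  obtain a0 where "t0 < a0" "a0 < t2" "local_max g a0"
    using local_max_between[OF c, of t0 t1 t2] assms by auto
  moreover obtain a1 where "t2 < a1" "a1 < t4" "local_max g a1"
    using local_max_between[OF c, of t2 t3 t4] assms by auto
  moreover obtain a2 where "t4 < a2" "a2 < t0 + 2*pi" "local_max g a2"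
    using local_max_between[OF c, of t4 t5 "t0 + 2*pi"] assms by auto
  moreover obtain b0 where "t1 < b0" "b0 < t3" "local_max (\<lambda>s. - g s) b0"
    using local_max_between[OF c', of t1 t2 t3] assms by auto
  moreover obtain b1 where "t3 < b1" "b1 < t5" "local_max (\<lambda>s. - g s) b1"
    using local_max_between[OF c', of t3 t4 t5] assms by auto
  moreover obtain b2 where "t5 < b2" "b2 < t1 + 2*pi" "local_max (\<lambda>s. - g s) b2"
    using local_max_between[OF c', of t5 "t0 + 2*pi" "t1 + 2*pi"] assms by auto
  ultimately show ?thesis
    using per by (intro six_local_extr[of g a0 a1 a2 b0 b1 b2]) auto
qed

section \<open>Sign changes of a function on an interval\<close>

lemma sign_pattern_or_single_change:
  fixes f :: "real \<Rightarrow> real"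
  assumes "p < q"
  shows "(\<exists>a b d. p < a \<and> a < b \<and> b < d \<and> d < q \<and>
            (f a > 0 \<and> f b < 0 \<and> f d > 0 \<or> f a < 0 \<and> f b > 0 \<and> f d < 0)) \<or>
         (\<exists>s\<in>{p..q}. (\<forall>t. p < t \<and> t < q \<longrightarrow> f t * (t - s) \<ge> 0) \<or>
                      (\<forall>t. p < t \<and> t < q \<longrightarrow> f t * (t - s) \<le> 0))"
    (is "?pat \<or> ?one")
proof (subst disj_imp, rule impI)
  assume np: "\<not> ?pat"
  \<comment> \<open>If no positive value follows a negative one, the change happens at the supremum
    of the points with positive value. Inserting \<open>p\<close> makes the set nonempty;
    \<open>s\<close> at an end of the interval covers the case of no change.\<close>
  have key: "\<exists>s\<in>{p..q}. \<forall>t. p < t \<and> t < q \<longrightarrow> h t * (t - s) \<le> 0"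
    if np: "\<not> (\<exists>a b. p < a \<and> a < b \<and> b < q \<and> h a < 0 \<and> h b > 0)" for h :: "real \<Rightarrow> real"
  proof -
    define A where "A = insert p {t. p < t \<and> t < q \<and> h t > 0}"
    have bd: "bdd_above A" using \<open>p < q\<close> by (auto simp: A_def intro!: bdd_aboveI[of _ q])
    have "p \<le> Sup A" using bd by (intro cSup_upper) (auto simp: A_def)
    moreover have "Sup A \<le> q" using \<open>p < q\<close> by (intro cSup_least) (auto simp: A_def)
    moreover have "h t * (t - Sup A) \<le> 0" if t: "p < t" "t < q" for t
    proof (cases "t < Sup A")
      case True
      then obtain t' where "t' \<in> A" "t < t'" using less_cSup_iff[of A t] bd by (auto simp: A_def)
      then have "\<not> h t < 0" using np t by (auto simp: A_def)
      then show ?thesis using True by (intro mult_nonneg_nonpos) auto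
    next
      case False
      then have "t \<in> A \<Longrightarrow> t = Sup A" using cSup_upper[OF _ bd, of t] by linarith
      then have "h t \<le> 0 \<or> t = Sup A" using t by (force simp: A_def)
      then show ?thesis using False by (auto intro: mult_nonpos_nonneg)
    qed
    ultimately show ?thesis by (intro bexI[of _ "Sup A"]) auto
  qed
  show ?one
  proof (cases "\<exists>a b. p < a \<and> a < b \<and> b < q \<and> f a < 0 \<and> f b > 0")
    case False
    then show ?thesis using key[of f] by blast
  next
    case True
    then obtain a b where ab: "p < a" "a < b" "b < q" "f a < 0" "f b > 0" by blast
    have "\<not> (\<exists>a' b'. p < a' \<and> a' < b' \<and> b' < q \<and> f a' > 0 \<and> f b' < 0)"
    proof
      assume "\<exists>a' b'. p < a' \<and> a' < b' \<and> b' < q \<and> f a' > 0 \<and> f b' < 0"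
      then obtain a' b' where ab': "p < a'" "a' < b'" "b' < q" "f a' > 0" "f b' < 0" by blast
      \<comment> \<open>A rise and a fall together contain a forbidden triple:
        \<open>a, a', b'\<close> with signs - + - in the first case, \<open>a', a, b\<close> with
        signs + - + in the second.\<close>
      consider "a < a'" | "a' < a" using ab ab' by (metis linorder_cases less_asym)
      then show False
      proof cases
        case 1 then show False using np ab ab' by blast
      next
        case 2 then show False using np ab ab' by blast
      qed
    qed
    then have "\<exists>s\<in>{p..q}. \<forall>t. p < t \<and> t < q \<longrightarrow> - f t * (t - s) \<le> 0" using key[of "\<lambda>t. - f t"] by auto
    then show ?thesis by auto
  qed
qed

section \<open>Curves with chords of constant length\<close>

lemma derivative_zero_if_locally_constant:
  assumes "(f has_real_derivative D) (at t)" and "p < t" "t < q"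
    and "\<And>u. p < u \<Longrightarrow> u < q \<Longrightarrow> f u = C"
  shows "D = 0"
proof -
  have "(f has_real_derivative 0) (at t)"
    by (rule has_field_derivative_transform_within_open[OF DERIV_const[of C], of "{p<..<q}"])
      (use assms in auto)
  then show ?thesis using assms(1) DERIV_unique by blast
qed

text \<open>The tangent angle is a real-valued lift, so the turning of an arc is a difference of two
  values. \<open>\<theta>_turn\<close> fixes the total turning at one counterclockwise turn.\<close>

locale angle_curve =
  fixes x y \<theta> k :: "real \<Rightarrow> real"
  assumes dx: "(x has_real_derivative cos (\<theta> t)) (at t)"
    and dy: "(y has_real_derivative sin (\<theta> t)) (at t)"
    and d\<theta>: "(\<theta> has_real_derivative k t) (at t)"
    and cont_k: "continuous_on UNIV k"
    and k_nonneg: "k t \<ge> 0"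
    and x_periodic: "x (t + 2*pi) = x t"
    and y_periodic: "y (t + 2*pi) = y t"
    and \<theta>_turn: "\<theta> (t + 2*pi) = \<theta> t + 2*pi"
begin

lemma \<theta>_mono: "s \<le> t \<Longrightarrow> \<theta> s \<le> \<theta> t"
  by (rule DERIV_nonneg_imp_nondecreasing) (use d\<theta> k_nonneg in auto)

lemma cont_\<theta>: "continuous_on A \<theta>"
  using d\<theta> by (meson DERIV_isCont continuous_at_imp_continuous_on)

lemma cont_x: "continuous_on A x"
  using dx by (meson DERIV_isCont continuous_at_imp_continuous_on)

lemma cont_y: "continuous_on A y"
  using dy by (meson DERIV_isCont continuous_at_imp_continuous_on)

lemma k_periodic: "k (t + 2*pi) = k t"
proof -
  have "((\<lambda>t. \<theta> (t + 2*pi)) has_real_derivative k (t + 2*pi)) (at t)"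
    using d\<theta>[of "t + 2*pi"] by (simp add: DERIV_shift)
  moreover have "((\<lambda>t. \<theta> (t + 2*pi)) has_real_derivative k t) (at t)"
    unfolding \<theta>_turn by (auto intro!: derivative_eq_intros d\<theta>)
  ultimately show ?thesis by (rule DERIV_unique)
qed

lemmas dsin = DERIV_fun_sin[OF d\<theta>]
lemmas dcos = DERIV_fun_cos[OF d\<theta>]

text \<open>The end point condition says that the circle of curvature \<open>c\<close> tangent to the curve at
  \<open>p\<close> is also tangent at \<open>q\<close>. It makes \<open>k - c\<close> orthogonal to \<open>cos \<theta>\<close> and \<open>sin \<theta>\<close> on \<open>[p,q]\<close>,
  hence to \<open>sin (\<theta> - \<theta> s)\<close>, whose only sign change is at \<open>s\<close>.\<close>

lemma sign_pattern_on_arc: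
  assumes "p < q" "\<theta> p < \<theta> q" "\<theta> q \<le> \<theta> p + pi"
    and ex: "c * x q - sin (\<theta> q) = c * x p - sin (\<theta> p)"
    and ey: "c * y q + cos (\<theta> q) = c * y p + cos (\<theta> p)"
  shows "(\<forall>t. p < t \<longrightarrow> t < q \<longrightarrow> k t = c) \<or>
    (\<exists>a b d. p < a \<and> a < b \<and> b < d \<and> d < q \<and>
       (k a > c \<and> k b < c \<and> k d > c \<or> k a < c \<and> k b > c \<and> k d < c))"
    (is "?const \<or> ?pat")
proof (subst disj_commute, subst disj_imp, rule impI)
  assume np: "\<not> ?pat"
  let ?f = "\<lambda>t. k t - c"
  obtain s where s: "s \<in> {p..q}"
    and one: "(\<forall>t. p < t \<and> t < q \<longrightarrow> ?f t * (t - s) \<ge> 0) \<or>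
              (\<forall>t. p < t \<and> t < q \<longrightarrow> ?f t * (t - s) \<le> 0)"
    using sign_pattern_or_single_change[OF \<open>p < q\<close>, of ?f] np by auto
  define w where "w t = sin (\<theta> t - \<theta> s)" for t
  \<comment> \<open>\<open>H\<close> combines the two functions of the end point conditions so that
    its derivative is \<open>(k - c) * w\<close>; these conditions therefore give equal values of
    \<open>H\<close> at \<open>p\<close> and \<open>q\<close>.\<close>
  define H where "H t = (c * x t - sin (\<theta> t)) * sin (\<theta> s) - (c * y t + cos (\<theta> t)) * cos (\<theta> s)" for t
  have dH: "(H has_real_derivative ?f t * w t) (at t)" for t
    unfolding H_def w_def sin_diff
    by (rule derivative_eq_intros dx dy d\<theta> refl)+ (simp add: algebra_simps)
  \<comment> \<open>As the arc turns by at most pi, \<open>\<theta> t - \<theta> s\<close> stays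
    within [-pi, pi] and has the sign of \<open>t - s\<close> or vanishes.\<close>
  have w_sign: "w t * (t - s) \<ge> 0" if "p < t" "t < q" for t
  proof (cases "t \<ge> s")
    case True
    then have "w t \<ge> 0" unfolding w_def
      using \<theta>_mono[of s t] \<theta>_mono[of t q] \<theta>_mono[of p s] s that assms by (intro sin_ge_zero) auto
    then show ?thesis using True by simp
  next
    case False
    then have "sin (\<theta> s - \<theta> t) \<ge> 0"
      using \<theta>_mono[of t s] \<theta>_mono[of p t] \<theta>_mono[of s q] s that assms by (intro sin_ge_zero) auto
    then have "w t \<le> 0" unfolding w_def using sin_minus[of "\<theta> s - \<theta> t"] by simp
    then show ?thesis using False by (intro mult_nonpos_nonpos) auto
  qed
  \<comment> \<open>Both factors change sign at most at \<open>s\<close>, so the product keeps one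
    sign. Then \<open>H\<close> is monotone with equal end values, hence constant, and its
    derivative vanishes.\<close>
  have fw_const: "?f t * w t = 0" if t: "p < t" "t < q" for t
  proof -
    have Hpq: "H p = H q" unfolding H_def using ex ey by simp
    have "(\<forall>t. p < t \<and> t < q \<longrightarrow> ?f t * w t \<ge> 0) \<or> (\<forall>t. p < t \<and> t < q \<longrightarrow> ?f t * w t \<le> 0)"
      using one
    proof (elim disjE)
      assume a: "\<forall>t. p < t \<and> t < q \<longrightarrow> ?f t * (t - s) \<ge> 0"
      have "?f t * w t \<ge> 0" if t: "p < t" "t < q" for t
      proof (cases "t = s")
        case False
        have "0 \<le> (?f t * (t - s)) * (w t * (t - s))" using mult_nonneg_nonneg[of "?f t * (t - s)" "w t * (t - s)"] a w_sign t by blast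
        also have "\<dots> = (?f t * w t) * (t - s)^2" by (simp add: power2_eq_square)
        finally show ?thesis using False by (simp add: zero_le_mult_iff)
      qed (simp add: w_def)
      then show ?thesis by blast
    next
      assume a: "\<forall>t. p < t \<and> t < q \<longrightarrow> ?f t * (t - s) \<le> 0"
      have "?f t * w t \<le> 0" if t: "p < t" "t < q" for t
      proof (cases "t = s")
        case False
        have "0 \<ge> (?f t * (t - s)) * (w t * (t - s))" using mult_nonpos_nonneg[of "?f t * (t - s)" "w t * (t - s)"] a w_sign t by blast
        also have "(?f t * (t - s)) * (w t * (t - s)) = (?f t * w t) * (t - s)^2" by (simp add: power2_eq_square)
        finally show ?thesis using False by (simp add: mult_le_0_iff)
      qed (simp add: w_def)
      then show ?thesis by blast
    qed
    then have "\<forall>u. p < u \<and> u < q \<longrightarrow> H u = H p"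
    proof (elim disjE)
      assume a: "\<forall>t. p < t \<and> t < q \<longrightarrow> ?f t * w t \<ge> 0"
      have "H u \<le> H v" if "p \<le> u" "u \<le> v" "v \<le> q" for u v
        using that a by (intro DERIV_nonneg_imp_increasing_open[of u v H])
          (auto intro!: dH exI continuous_at_imp_continuous_on DERIV_isCont[OF dH])
      then show ?thesis using Hpq by (metis less_le_not_le order.antisym order_refl)
    next
      assume a: "\<forall>t. p < t \<and> t < q \<longrightarrow> ?f t * w t \<le> 0"
      have "H v \<le> H u" if "p \<le> u" "u \<le> v" "v \<le> q" for u v
        using that a by (intro DERIV_nonpos_imp_decreasing_open[of u v H])
          (auto intro!: dH exI continuous_at_imp_continuous_on DERIV_isCont[OF dH])
      then show ?thesis using Hpq by (metis less_le_not_le order.antisym order_refl)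
    qed
    then show ?thesis using derivative_zero_if_locally_constant[OF dH t] by blast
  qed
  \<comment> \<open>The factor \<open>w\<close> may vanish on a whole interval where the curve is
    straight. Where \<open>k\<close> differs from \<open>c\<close>, \<open>w\<close> vanishes
    nearby, so its derivative \<open>cos (\<theta> t - \<theta> s) * k t\<close> is zero too; the
    cosine is 1 or -1 there, leaving \<open>k t = 0\<close>.\<close>
  have two_values: "k t = c \<or> k t = 0" if t: "p < t" "t < q" for t
  proof (rule disjCI)
    assume "k t \<noteq> 0"
    show "k t = c"
    proof (rule ccontr)
      assume ne: "k t \<noteq> c"
      have "open {u. k u \<noteq> c}" using cont_k by (intro open_Collect_neq) auto
      then have op: "open ({u. k u \<noteq> c} \<inter> {p<..<q})" by auto
      have "(w has_real_derivative 0) (at t)"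
        using t ne fw_const
        by (intro has_field_derivative_transform_within_open[OF DERIV_const[of 0] op]) auto
      moreover have "(w has_real_derivative cos (\<theta> t - \<theta> s) * k t) (at t)"
        unfolding w_def by (auto intro!: derivative_eq_intros d\<theta>)
      ultimately have "cos (\<theta> t - \<theta> s) * k t = 0" by (metis DERIV_unique)
      moreover have "sin (\<theta> t - \<theta> s) = 0" using fw_const[OF t] ne by (simp add: w_def)
      ultimately show False using \<open>k t \<noteq> 0\<close> sin_zero_abs_cos_one by fastforce
    qed
  qed
  show ?const
  proof (rule ccontr)
    assume "\<not> ?const"
    then obtain a where a: "p < a" "a < q" "k a \<noteq> c" by blast
    \<comment> \<open>Taking both values 0 and \<open>c\<close>, the continuous \<open>k\<close>
      would also take \<open>c / 2\<close>, a third value. So \<open>k\<close> vanishes on the whole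
      arc, against its positive turning.\<close>
    have "k t \<noteq> c" if t: "p < t" "t < q" for t
    proof
      assume "k t = c"
      define m where "m = c / 2"
      have ka: "k a = 0" and "c \<noteq> 0" using two_values a by auto
      have cc: "connected (k ` {p<..<q})"
        using cont_k by (intro connected_continuous_image continuous_on_subset[OF cont_k]) auto
      have "c \<ge> 0" using \<open>k t = c\<close> k_nonneg[of t] by simp
      then have "m \<in> k ` {p<..<q}"
        using connectedD_interval[OF cc, of 0 c m] ka \<open>k t = c\<close> a t by (force simp: m_def)
      then obtain u where "p < u" "u < q" "k u = m" by auto
      then show False using two_values[of u] \<open>c \<noteq> 0\<close> by (simp add: m_def)
    qed
    then have "k t = 0" if "p < t" "t < q" for t using two_values that by blast
    then have "\<theta> q = \<theta> p"
      using \<open>p < q\<close> by (intro DERIV_isconst_end[OF \<open>p < q\<close> cont_\<theta>]) (metis d\<theta>)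
    then show False using \<open>\<theta> p < \<theta> q\<close> by simp
  qed
qed

end

section \<open>Turning of the arcs and bitangent circles\<close>

locale bicycle = angle_curve +
  fixes \<alpha> l :: real
  assumes \<alpha>: "0 < \<alpha>" "\<alpha> < 2*pi"
    and l: "l > 0"
    and chord: "(x (t + \<alpha>) - x t)\<^sup>2 + (y (t + \<alpha>) - y t)\<^sup>2 = l\<^sup>2"
begin

text \<open>An arc that does not turn is a segment, so \<open>l = \<alpha>\<close>. Then every arc
  of length \<open>\<alpha>\<close> is as short as its chord, hence straight, and the curvature
  vanishes everywhere, which contradicts the full turn.\<close>

lemma arc_turns: "\<theta> t < \<theta> (t + \<alpha>)"
proof (rule ccontr)
  assume "\<not> \<theta> t < \<theta> (t + \<alpha>)"
  then have th: "\<theta> u = \<theta> t" if "u \<in> {t..t+\<alpha>}" for u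
    using \<theta>_mono[of t u] \<theta>_mono[of u "t + \<alpha>"] that by simp
  have "((\<lambda>u. x u - cos (\<theta> t) * u) has_real_derivative 0) (at u)" if "u \<in> {t..t+\<alpha>}" for u
    by (rule derivative_eq_intros dx refl)+ (simp add: th[OF that])
  then have "x (t + \<alpha>) - cos (\<theta> t) * (t + \<alpha>) = x t - cos (\<theta> t) * t"
    using \<alpha> by (intro DERIV_isconst_end[of t "t + \<alpha>" "\<lambda>u. x u - cos (\<theta> t) * u"]) (auto intro!: continuous_intros cont_x)
  then have X: "x (t + \<alpha>) - x t = \<alpha> * cos (\<theta> t)" by (simp add: algebra_simps)
  have "((\<lambda>u. y u - sin (\<theta> t) * u) has_real_derivative 0) (at u)" if "u \<in> {t..t+\<alpha>}" for u
    by (rule derivative_eq_intros dy refl)+ (simp add: th[OF that])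
  then have "y (t + \<alpha>) - sin (\<theta> t) * (t + \<alpha>) = y t - sin (\<theta> t) * t"
    using \<alpha> by (intro DERIV_isconst_end[of t "t + \<alpha>" "\<lambda>u. y u - sin (\<theta> t) * u"]) (auto intro!: continuous_intros cont_y)
  then have Y: "y (t + \<alpha>) - y t = \<alpha> * sin (\<theta> t)" by (simp add: algebra_simps)
  have "l\<^sup>2 = \<alpha>\<^sup>2 * ((cos (\<theta> t))\<^sup>2 + (sin (\<theta> t))\<^sup>2)"
    using chord[of t] unfolding X Y by (simp only: power_mult_distrib distrib_left)
  then have l2: "l\<^sup>2 = \<alpha>\<^sup>2" by simp
  have mid: "k (s + \<alpha>/2) = 0" for s
  proof -
    define a b where "a = (x (s + \<alpha>) - x s) / \<alpha>" and "b = (y (s + \<alpha>) - y s) / \<alpha>"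
    have ab: "a\<^sup>2 + b\<^sup>2 = 1"
      using chord[of s] l2 \<alpha> by (simp add: a_def b_def power_divide flip: add_divide_distrib)
    \<comment> \<open>\<open>G\<close> is arc length minus the projection to the unit chord
      direction \<open>(a, b)\<close>. Its derivative is half the squared distance from the tangent
      to \<open>(a, b)\<close>, and its values at the ends of the arc agree, so the tangent equals
      \<open>(a, b)\<close> inside the arc.\<close>
    define G where "G u = u - a * x u - b * y u" for u
    have dG: "(G has_real_derivative 1 - a * cos (\<theta> u) - b * sin (\<theta> u)) (at u)" for u
      unfolding G_def by (rule derivative_eq_intros dx dy refl)+ simp
    have sq: "(cos (\<theta> u) - a)\<^sup>2 + (sin (\<theta> u) - b)\<^sup>2 = 2 * (1 - a * cos (\<theta> u) - b * sin (\<theta> u))" for u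
      using ab sin_cos_squared_add[of "\<theta> u"] by (simp add: power2_eq_square algebra_simps)
    have nonneg: "0 \<le> 1 - a * cos (\<theta> u) - b * sin (\<theta> u)" for u
    proof -
      have "0 \<le> 2 * (1 - a * cos (\<theta> u) - b * sin (\<theta> u))" unfolding sq[symmetric] by simp
      moreover have "0 \<le> 2 * z \<Longrightarrow> 0 \<le> z" for z :: real by simp
      ultimately show ?thesis by blast
    qed
    have Gm: "G u \<le> G v" if "u \<le> v" for u v
      by (rule DERIV_nonneg_imp_nondecreasing[OF that]) (intro exI conjI, rule dG, rule nonneg)
    have "a * (x (s + \<alpha>) - x s) + b * (y (s + \<alpha>) - y s) = \<alpha> * (a\<^sup>2 + b\<^sup>2)"
      using \<alpha> by (simp add: a_def b_def power2_eq_square field_simps)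
    then have "G (s + \<alpha>) = G s" using ab by (simp add: G_def algebra_simps)
    then have Gc: "G u = G s" if "u \<in> {s..s+\<alpha>}" for u
      using Gm[of s u] Gm[of u "s + \<alpha>"] that by simp
    have const: "cos (\<theta> u) = a \<and> sin (\<theta> u) = b" if u: "u \<in> {s<..<s+\<alpha>}" for u
    proof -
      have "s < u" "u < s + \<alpha>" using u by auto
      then have "1 - a * cos (\<theta> u) - b * sin (\<theta> u) = 0"
        by (rule derivative_zero_if_locally_constant[OF dG]) (rule Gc, simp)
      then show ?thesis using sq[of u] by (simp add: sum_power2_eq_zero_iff)
    qed
    let ?u = "s + \<alpha>/2"
    have u: "s < ?u" "?u < s + \<alpha>" using \<alpha> by auto
    have "- sin (\<theta> ?u) * k ?u = 0"
      by (rule derivative_zero_if_locally_constant[OF dcos u]) (use const in auto)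
    moreover have "cos (\<theta> ?u) * k ?u = 0"
      by (rule derivative_zero_if_locally_constant[OF dsin u]) (use const in auto)
    ultimately show ?thesis using sin_zero_abs_cos_one[of "\<theta> ?u"] by auto
  qed
  have "k u = 0" for u using mid[of "u - \<alpha>/2"] by simp
  then have "\<theta> (0 + 2*pi) = \<theta> 0"
    by (intro DERIV_isconst_all) (metis d\<theta>)
  then show False unfolding \<theta>_turn by simp
qed

text \<open>The complementary arc has the same chord, traversed backwards. This transfers every
  result about arcs to the complementary ones.\<close>

lemma complement: "bicycle x y \<theta> k (2*pi - \<alpha>) l"
proof
  show "0 < 2*pi - \<alpha>" "2*pi - \<alpha> < 2*pi" "l > 0" using \<alpha> l by auto
  show "(x (t + (2*pi - \<alpha>)) - x t)\<^sup>2 + (y (t + (2*pi - \<alpha>)) - y t)\<^sup>2 = l\<^sup>2" for t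
    using chord[of "t - \<alpha>"] x_periodic[of "t - \<alpha>"] y_periodic[of "t - \<alpha>"]
    by (simp add: algebra_simps power2_commute)
qed

lemma arc_turns_less: "\<theta> (t + \<alpha>) < \<theta> t + 2*pi"
proof -
  interpret c: bicycle x y \<theta> k "2*pi - \<alpha>" l by (rule complement)
  show ?thesis using c.arc_turns[of "t + \<alpha>"] by (simp add: \<theta>_turn)
qed

text \<open>A chord of constant length makes equal angles with the curve at its ends, so there is a
  circle tangent to the curve at both.\<close>

lemma bitangent_circle:
  obtains c where "c * x (t + \<alpha>) - sin (\<theta> (t + \<alpha>)) = c * x t - sin (\<theta> t)"
    and "c * y (t + \<alpha>) + cos (\<theta> (t + \<alpha>)) = c * y t + cos (\<theta> t)"
    and "k t + k (t + \<alpha>) = 2 * c"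
proof -
  \<comment> \<open>\<open>(X, Y)\<close> is the chord vector and \<open>(C, S)\<close> its
    derivative, the difference of the end tangents. Constant length makes the two
    orthogonal.\<close>
  define X Y C S where "X u = x (u + \<alpha>) - x u" and "Y u = y (u + \<alpha>) - y u"
    and "C u = cos (\<theta> (u + \<alpha>)) - cos (\<theta> u)" and "S u = sin (\<theta> (u + \<alpha>)) - sin (\<theta> u)" for u
  have sh: "((\<lambda>u. f (u + \<alpha>)) has_real_derivative D) (at u)"
    if "(f has_real_derivative D) (at (u + \<alpha>))" for f D u using that by (simp add: DERIV_shift)
  note shs = sh[of x, OF dx] sh[of y, OF dy] sh[of \<theta>, OF d\<theta>]
  have dX: "(X has_real_derivative C u) (at u)" for u
    unfolding X_def C_def by (rule derivative_eq_intros dx shs refl)+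
  have dY: "(Y has_real_derivative S u) (at u)" for u
    unfolding Y_def S_def by (rule derivative_eq_intros dy shs refl)+
  have "((\<lambda>u. (X u)\<^sup>2 + (Y u)\<^sup>2) has_real_derivative 2 * (X u * C u + Y u * S u)) (at u)" for u
    by (rule derivative_eq_intros dX dY refl)+ (simp add: algebra_simps)
  moreover have len: "(X u)\<^sup>2 + (Y u)\<^sup>2 = l\<^sup>2" for u unfolding X_def Y_def by (rule chord)
  ultimately have perp: "X u * C u + Y u * S u = 0" for u
    using DERIV_unique[OF _ DERIV_const[of "l\<^sup>2"]] by (metis (no_types, lifting) mult_eq_0_iff zero_neq_numeral ext)
  define a b a' b' where "a = cos (\<theta> t)" and "b = sin (\<theta> t)"
    and "a' = cos (\<theta> (t + \<alpha>))" and "b' = sin (\<theta> (t + \<alpha>))"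
  have dC: "(C has_real_derivative - b' * k (t + \<alpha>) + b * k t) (at t)"
    unfolding C_def a_def b_def a'_def b'_def by (rule derivative_eq_intros d\<theta> shs refl)+ simp
  have dS: "(S has_real_derivative a' * k (t + \<alpha>) - a * k t) (at t)"
    unfolding S_def a_def b_def a'_def b'_def by (rule derivative_eq_intros d\<theta> shs refl)+
  have "((\<lambda>u. X u * C u + Y u * S u) has_real_derivative
     C t * C t + S t * S t + X t * (- b' * k (t + \<alpha>) + b * k t) + Y t * (a' * k (t + \<alpha>) - a * k t)) (at t)"
    by (rule derivative_eq_intros dX dY dC dS refl)+ (simp add: algebra_simps)
  then have L3: "C t * C t + S t * S t + X t * (- b' * k (t + \<alpha>) + b * k t) + Y t * (a' * k (t + \<alpha>) - a * k t) = 0"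
    unfolding perp by (rule DERIV_unique[OF _ DERIV_const])
  \<comment> \<open>By orthogonality \<open>(S, -C)\<close> is a multiple of the chord vector
    \<open>(X, Y)\<close>; \<open>c\<close> is the factor, obtained by projection.\<close>
  define c where "c = (S t * X t - C t * Y t) / l\<^sup>2"
  have cl: "c * l\<^sup>2 = S t * X t - C t * Y t" using l by (simp add: c_def)
  have "c * X t * l\<^sup>2 = (S t * X t - C t * Y t) * X t" using cl by algebra
  also have "\<dots> = S t * ((X t)\<^sup>2 + (Y t)\<^sup>2)" using perp[of t] by algebra
  finally have cX: "c * X t = S t" unfolding len using l mult_right_cancel[of "l\<^sup>2"] by simp
  have "c * Y t * l\<^sup>2 = (S t * X t - C t * Y t) * Y t" using cl by algebra
  also have "\<dots> = - C t * ((X t)\<^sup>2 + (Y t)\<^sup>2)" using perp[of t] by algebra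
  finally have cY: "c * Y t = - C t" unfolding len using l mult_right_cancel[of "l\<^sup>2" "c * Y t" "- C t"] by simp
  \<comment> \<open>For \<open>c = 0\<close> the end tangents agree, so the arc turns by a multiple
    of 2 pi, yet its turning lies strictly between 0 and 2 pi.\<close>
  have "c \<noteq> 0"
  proof
    assume "c = 0"
    then have "C t = 0" "S t = 0" using cX cY by auto
    then obtain n :: int where n: "\<theta> (t + \<alpha>) = \<theta> t + 2 * pi * n"
      using sin_cos_eq_iff[of "\<theta> (t + \<alpha>)" "\<theta> t"] by (auto simp: C_def S_def)
    have "0 < real_of_int n" using arc_turns[of t] unfolding n by (simp add: zero_less_mult_iff)
    moreover have "2 * pi * real_of_int n < 2 * pi * 1" using arc_turns_less[of t] unfolding n by simp
    then have "real_of_int n < 1" by (rule mult_left_less_imp_less) simp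
    ultimately show False by simp
  qed
  have CS: "C t = a' - a" "S t = b' - b" by (auto simp: C_def S_def a_def b_def a'_def b'_def)
  have unit: "a\<^sup>2 + b\<^sup>2 = 1" "a'\<^sup>2 + b'\<^sup>2 = 1" by (auto simp: a_def b_def a'_def b'_def)
  \<comment> \<open>These are the components of the chord normal to the two end tangents. The
    tangential components agree, so the normal ones agree up to sign; since \<open>c\<close> is
    nonzero they are opposite, and \<open>2 * n = c * l\<^sup>2\<close>.\<close>
  define n n' where "n = a * Y t - b * X t" and "n' = a' * Y t - b' * X t"
  have nd: "n' - n = - c * l\<^sup>2" unfolding n_def n'_def using cl CS by (simp add: algebra_simps)
  have eqT: "a' * X t + b' * Y t = a * X t + b * Y t" using perp[of t] CS by (simp add: algebra_simps)
  have "n'\<^sup>2 = (a'\<^sup>2 + b'\<^sup>2) * ((X t)\<^sup>2 + (Y t)\<^sup>2) - (a' * X t + b' * Y t)\<^sup>2" unfolding n'_def by algebra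
  also have "\<dots> = (a\<^sup>2 + b\<^sup>2) * ((X t)\<^sup>2 + (Y t)\<^sup>2) - (a * X t + b * Y t)\<^sup>2" unfolding eqT unit ..
  also have "\<dots> = n\<^sup>2" unfolding n_def by algebra
  finally have "(n' - n) * (n' + n) = 0" by algebra
  then have "n' = - n" using nd \<open>c \<noteq> 0\<close> l by auto
  then have nn: "2 * n = c * l\<^sup>2" using nd by simp
  have "C t * C t + S t * S t = (c * Y t) * (c * Y t) + (c * X t) * (c * X t)" unfolding cX cY by simp
  also have "\<dots> = c\<^sup>2 * ((X t)\<^sup>2 + (Y t)\<^sup>2)" by (simp add: power2_eq_square algebra_simps)
  finally have cc: "C t * C t + S t * S t = c\<^sup>2 * l\<^sup>2" unfolding len .
  \<comment> \<open>The derivative of the orthogonality relation brings in the curvatures.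
    Substituting the values of \<open>n\<close> and \<open>n'\<close> turns it into the mean value
    relation for \<open>c\<close>.\<close>
  have "c\<^sup>2 * l\<^sup>2 + n' * k (t + \<alpha>) - n * k t = 0"
    using L3 unfolding cc n_def n'_def by (simp add: algebra_simps)
  then have "c\<^sup>2 * l\<^sup>2 = n * (k t + k (t + \<alpha>))"
    unfolding \<open>n' = - n\<close> by (simp add: algebra_simps)
  moreover have "(c * l\<^sup>2) * (2 * c) = 2 * (c\<^sup>2 * l\<^sup>2)" by (simp add: power2_eq_square)
  ultimately have "(c * l\<^sup>2) * (2 * c) = (2 * n) * (k t + k (t + \<alpha>))" by simp
  then have "(c * l\<^sup>2) * (2 * c) = (c * l\<^sup>2) * (k t + k (t + \<alpha>))" unfolding nn .
  then have "k t + k (t + \<alpha>) = 2 * c" using \<open>c \<noteq> 0\<close> l by simp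
  then show ?thesis using cX cY by (intro that[of c]) (auto simp: X_def Y_def C_def S_def algebra_simps)
qed

text \<open>The middle point of the sign triple yields one kind of extremum. For the other kind, the
  values of \<open>k\<close> at the ends have mean \<open>c\<close>, so one end lies weakly on the
  side of the middle value, and the outer point next to that end is extreme between the two.\<close>

lemma local_max_min_on_arc:
  assumes "\<theta> (t + \<alpha>) \<le> \<theta> t + pi" and nc: "\<And>p q C. p < q \<Longrightarrow> \<exists>u. p < u \<and> u < q \<and> k u \<noteq> C"
  shows "\<exists>u. t < u \<and> u < t + \<alpha> \<and> local_max k u"
    and "\<exists>u. t < u \<and> u < t + \<alpha> \<and> local_max (\<lambda>s. - k s) u"
proof -
  obtain c where ct: "c * x (t + \<alpha>) - sin (\<theta> (t + \<alpha>)) = c * x t - sin (\<theta> t)"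
    "c * y (t + \<alpha>) + cos (\<theta> (t + \<alpha>)) = c * y t + cos (\<theta> t)"
    and kk: "k t + k (t + \<alpha>) = 2 * c" by (rule bitangent_circle)
  have "t < t + \<alpha>" using \<alpha> by simp
  then obtain a b d where abd: "t < a" "a < b" "b < d" "d < t + \<alpha>"
    and pat: "k a > c \<and> k b < c \<and> k d > c \<or> k a < c \<and> k b > c \<and> k d < c"
    using sign_pattern_on_arc[OF _ arc_turns assms(1) ct] nc[of t "t + \<alpha>" c] by blast
  have cm: "continuous_on UNIV (\<lambda>s. - k s)" using cont_k by (intro continuous_intros)
  have ends: "k t \<le> c \<or> k (t + \<alpha>) \<le> c" "k t \<ge> c \<or> k (t + \<alpha>) \<ge> c" using kk by auto
  have mx: "\<exists>u. t < u \<and> u < t + \<alpha> \<and> local_max g u"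
    if h: "continuous_on UNIV g" "t \<le> p" "p < m" "m < r" "r \<le> t + \<alpha>" "g p < g m" "g r < g m" for g p m r
  proof -
    obtain u where "p < u" "u < r" "local_max g u"
      by (rule local_max_between[OF h(1,3,4,6,7)])
    then show ?thesis using h(2,5) by (intro exI[of _ u]) simp
  qed
  show "\<exists>u. t < u \<and> u < t + \<alpha> \<and> local_max k u"
    using pat
  proof (elim disjE)
    assume p: "k a > c \<and> k b < c \<and> k d > c"
    show ?thesis using ends(1)
    proof
      assume "k t \<le> c" then show ?thesis by (intro mx[OF cont_k, of t a b]) (use p abd in auto)
    next
      assume "k (t + \<alpha>) \<le> c" then show ?thesis by (intro mx[OF cont_k, of b d "t + \<alpha>"]) (use p abd in auto)
    qed
  next
    assume "k a < c \<and> k b > c \<and> k d < c"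
    then show ?thesis by (intro mx[OF cont_k, of a b d]) (use abd in auto)
  qed
  show "\<exists>u. t < u \<and> u < t + \<alpha> \<and> local_max (\<lambda>s. - k s) u"
    using pat
  proof (elim disjE)
    assume p: "k a < c \<and> k b > c \<and> k d < c"
    show ?thesis using ends(2)
    proof
      assume "k t \<ge> c" then show ?thesis by (intro mx[OF cm, of t a b]) (use p abd in auto)
    next
      assume "k (t + \<alpha>) \<ge> c" then show ?thesis by (intro mx[OF cm, of b d "t + \<alpha>"]) (use p abd in auto)
    qed
  next
    assume "k a > c \<and> k b < c \<and> k d > c"
    then show ?thesis by (intro mx[OF cm, of a b d]) (use abd in auto)
  qed
qed

section \<open>Six extrema of the curvature\<close>

abbreviation "extrema \<equiv> {t \<in> {0..<2*pi}. local_extr k t}"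

lemma six_extrema_if_short_arcs:
  assumes short: "\<And>t. \<theta> (t + \<alpha>) < \<theta> t + pi"
    and nc: "\<And>p q C. p < q \<Longrightarrow> \<exists>u. p < u \<and> u < q \<and> k u \<noteq> C"
  shows "infinite extrema \<or> card extrema \<ge> 6"
proof -
  \<comment> \<open>Otherwise two consecutive arcs of length pi would each turn by less than pi,
    although together they make a full turn.\<close>
  have "\<alpha> < pi"
  proof (rule ccontr)
    assume "\<not> \<alpha> < pi"
    then have "\<theta> (t + pi) < \<theta> t + pi" for t
      using \<theta>_mono[of "t + pi" "t + \<alpha>"] short[of t] by simp
    from this[of 0] this[of pi] show False using \<theta>_turn[of 0] by simp
  qed
  have le: "\<theta> (t + \<alpha>) \<le> \<theta> t + pi" for t using short[of t] by simp
  have mx: "\<exists>u. t < u \<and> u < t + \<alpha> \<and> local_max k u" for t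
    by (rule local_max_min_on_arc(1)[OF le]) (rule nc)
  have mn: "\<exists>u. t < u \<and> u < t + \<alpha> \<and> local_max (\<lambda>s. - k s) u" for t
    by (rule local_max_min_on_arc(2)[OF le]) (rule nc)
  \<comment> \<open>The arcs ending and starting at \<open>a1\<close> supply its neighbours, and all
    three lie within less than \<open>2 * \<alpha>\<close>, hence within one period. The minima are
    chosen likewise.\<close>
  obtain a1 where a1: "local_max k a1" using mx[of 0] by blast
  obtain a0 where a0: "a1 - \<alpha> < a0" "a0 < a1" "local_max k a0" using mx[of "a1 - \<alpha>"] by auto
  obtain a2 where a2: "a1 < a2" "a2 < a1 + \<alpha>" "local_max k a2" using mx[of a1] by auto
  obtain b1 where b1: "local_max (\<lambda>s. - k s) b1" using mn[of 0] by blast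
  obtain b0 where b0: "b1 - \<alpha> < b0" "b0 < b1" "local_max (\<lambda>s. - k s) b0" using mn[of "b1 - \<alpha>"] by auto
  obtain b2 where b2: "b1 < b2" "b2 < b1 + \<alpha>" "local_max (\<lambda>s. - k s) b2" using mn[of b1] by auto
  show ?thesis
    using a0 a1 a2 b0 b1 b2 \<open>\<alpha> < pi\<close> k_periodic
    by (intro six_local_extr[of k a0 a1 a2 b0 b1 b2]) auto
qed

lemma six_extrema_if_half_turn:
  assumes half: "\<theta> (t + \<alpha>) = \<theta> t + pi"
    and nc: "\<And>p q C. p < q \<Longrightarrow> \<exists>u. p < u \<and> u < q \<and> k u \<noteq> C"
  shows "infinite extrema \<or> card extrema \<ge> 6"
proof -
  obtain c where ct: "c * x (t + \<alpha>) - sin (\<theta> (t + \<alpha>)) = c * x t - sin (\<theta> t)"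
    "c * y (t + \<alpha>) + cos (\<theta> (t + \<alpha>)) = c * y t + cos (\<theta> t)"
    and kk: "k t + k (t + \<alpha>) = 2 * c" by (rule bitangent_circle)
  define q where "q = t + \<alpha>"
  have tq: "t < q" "q < t + 2*pi" using \<alpha> by (auto simp: q_def)
  obtain a b d where abd: "t < a" "a < b" "b < d" "d < q"
    and pat: "k a > c \<and> k b < c \<and> k d > c \<or> k a < c \<and> k b > c \<and> k d < c"
    using sign_pattern_on_arc[OF tq(1), of c] half ct nc[of t q c] tq unfolding q_def by force
  \<comment> \<open>The same \<open>c\<close> serves the complementary arc: its end points are the
    same modulo the period, and it also turns by pi.\<close>
  obtain a' b' d' where abd': "q < a'" "a' < b'" "b' < d'" "d' < t + 2*pi"
    and pat': "k a' > c \<and> k b' < c \<and> k d' > c \<or> k a' < c \<and> k b' > c \<and> k d' < c"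
    using sign_pattern_on_arc[OF tq(2), of c] half ct nc[of q "t + 2*pi" c] tq
    unfolding q_def by (force simp: \<theta>_turn x_periodic y_periodic)
  have up: "infinite extrema \<or> card extrema \<ge> 6"
    if "g = k \<or> g = (\<lambda>s. - k s)" "t0 < t1" "t1 < t2" "t2 < t3" "t3 < t4" "t4 < t5" "t5 < t0 + 2*pi"
     "g t0 < g t1" "g t2 < g t1" "g t2 < g t3" "g t4 < g t3" "g t4 < g t5" "g t0 < g t5"
    for g t0 t1 t2 t3 t4 t5
  proof -
    have "continuous_on UNIV g" using that(1) cont_k by (auto intro: continuous_intros)
    then have "infinite {t \<in> {0..<2*pi}. local_extr g t} \<or> card {t \<in> {0..<2*pi}. local_extr g t} \<ge> 6"
      using that k_periodic by (intro six_local_extr_if_zigzag[of g t0 t1 t2 t3 t4 t5]) auto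
    moreover have "local_extr g u = local_extr k u" for u using that(1) by auto
    ultimately show ?thesis by simp
  qed
  \<comment> \<open>Opposite patterns on the two arcs already alternate. For equal patterns the
    samples adjacent across \<open>t\<close>, or across \<open>q\<close>, are on the same side of
    \<open>c\<close>; the end value on the weakly opposite side is inserted at one junction and one
    sample is dropped at the other.\<close>
  have kq: "k t \<le> c \<and> k q \<ge> c \<or> k t \<ge> c \<and> k q \<le> c" using kk by (auto simp: q_def)
  have kt: "k (t + 2*pi) = k t" by (rule k_periodic)
  show ?thesis
    using pat
  proof (elim disjE)
    assume p1: "k a > c \<and> k b < c \<and> k d > c"
    show ?thesis using pat'
    proof (elim disjE)
      assume p2: "k a' > c \<and> k b' < c \<and> k d' > c"
      show ?thesis using kq
      proof (elim disjE)
        assume "k t \<le> c \<and> k q \<ge> c"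
        then show ?thesis by (intro up[of k t a b d b' d']) (use p1 p2 abd abd' tq in auto)
      next
        assume "k t \<ge> c \<and> k q \<le> c"
        then show ?thesis by (intro up[of "\<lambda>s. - k s" a b d q a' b']) (use p1 p2 abd abd' tq in auto)
      qed
    next
      assume p2: "k a' < c \<and> k b' > c \<and> k d' < c"
      show ?thesis by (intro up[of "\<lambda>s. - k s" a b d a' b' d']) (use p1 p2 abd abd' tq in auto)
    qed
  next
    assume p1: "k a < c \<and> k b > c \<and> k d < c"
    show ?thesis using pat'
    proof (elim disjE)
      assume p2: "k a' < c \<and> k b' > c \<and> k d' < c"
      show ?thesis using kq
      proof (elim disjE)
        assume "k t \<le> c \<and> k q \<ge> c"
        then show ?thesis by (intro up[of k a b d q a' b']) (use p1 p2 abd abd' tq in auto)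
      next
        assume "k t \<ge> c \<and> k q \<le> c"
        then show ?thesis by (intro up[of "\<lambda>s. - k s" t a b d b' d']) (use p1 p2 abd abd' tq in auto)
      qed
    next
      assume p2: "k a' > c \<and> k b' < c \<and> k d' > c"
      show ?thesis by (intro up[of k a b d a' b' d']) (use p1 p2 abd abd' tq in auto)
    qed
  qed
qed

theorem six_extrema: "infinite extrema \<or> card extrema \<ge> 6"
proof (cases "\<forall>p q C. p < q \<longrightarrow> (\<exists>u. p < u \<and> u < q \<and> k u \<noteq> C)")
  case False
  then show ?thesis using infinite_local_extr_if_constant[of k] k_periodic by blast
next
  case True
  then have nc: "\<exists>u. p < u \<and> u < q \<and> k u \<noteq> C" if "p < q" for p q C using that by blast
  define \<Delta> where "\<Delta> t = \<theta> (t + \<alpha>) - \<theta> t" for t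
  have cc: "connected (range \<Delta>)"
    unfolding \<Delta>_def
    by (intro connected_continuous_image continuous_intros continuous_on_compose2[OF cont_\<theta>[of UNIV]]) auto
  consider t where "\<Delta> t = pi" | "\<forall>t. \<Delta> t < pi" | "\<forall>t. \<Delta> t > pi"
    using connectedD_interval[OF cc, of _ _ pi] by (metis linorder_cases rangeE rangeI less_imp_le)
  then show ?thesis
  proof cases
    case 1 then show ?thesis by (intro six_extrema_if_half_turn[of t] nc) (auto simp: \<Delta>_def)
  next
    case 2 then show ?thesis by (intro six_extrema_if_short_arcs nc) (auto simp: \<Delta>_def algebra_simps)
  next
    case 3
    interpret c: bicycle x y \<theta> k "2*pi - \<alpha>" l by (rule complement)
    \<comment> \<open>The complementary arc starting at \<open>t\<close> completes the arc from
      \<open>t - \<alpha>\<close> to \<open>t\<close>, which turns by more than pi.\<close>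
    have "\<theta> (t + (2*pi - \<alpha>)) < \<theta> t + pi" for t
      using spec[OF 3, of "t - \<alpha>"] \<theta>_turn[of "t - \<alpha>"] by (simp add: \<Delta>_def algebra_simps)
    then show ?thesis by (intro c.six_extrema_if_short_arcs nc)
  qed
qed

end

section \<open>Convex curves\<close>

text \<open>A simple closed curve lying to the left of each of its tangent lines. Nonnegative
  curvature and total turning 2 pi are derived from this.\<close>

locale supported_curve =
  fixes x y \<theta> k :: "real \<Rightarrow> real"
  assumes dx: "(x has_real_derivative cos (\<theta> t)) (at t)"
    and dy: "(y has_real_derivative sin (\<theta> t)) (at t)"
    and d\<theta>: "(\<theta> has_real_derivative k t) (at t)"
    and x_periodic: "x (t + 2*pi) = x t"
    and y_periodic: "y (t + 2*pi) = y t"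
    and simple: "a < b \<Longrightarrow> b < a + 2*pi \<Longrightarrow> x a = x b \<Longrightarrow> y a \<noteq> y b"
    and support: "cos (\<theta> t) * (y s - y t) - sin (\<theta> t) * (x s - x t) \<ge> 0"
begin

text \<open>With negative curvature at \<open>t\<close> the tangent turns right just afterwards, and
  the height \<open>h\<close> above the tangent line at \<open>t\<close> would become
  negative.\<close>

lemma k_nonneg: "k t \<ge> 0"
proof (rule ccontr)
  assume "\<not> k t \<ge> 0"
  then have neg: "cos (\<theta> t - \<theta> t) * k t < 0" by simp
  define h where "h s = cos (\<theta> t) * (y s - y t) - sin (\<theta> t) * (x s - x t)" for s
  have dh: "(h has_real_derivative sin (\<theta> s - \<theta> t)) (at s)" for s
    unfolding h_def sin_diff by (rule derivative_eq_intros dx dy refl)+ simp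
  have "((\<lambda>s. sin (\<theta> s - \<theta> t)) has_real_derivative cos (\<theta> t - \<theta> t) * k t) (at t)"
    by (rule derivative_eq_intros d\<theta> refl)+ simp
  from DERIV_neg_dec_right[OF this neg] obtain d where "d > 0"
    and d: "\<And>e. 0 < e \<Longrightarrow> e < d \<Longrightarrow> sin (\<theta> (t + e) - \<theta> t) < 0" by auto
  obtain z where z: "t < z" "z < t + d/2" "h (t + d/2) - h t = (t + d/2 - t) * sin (\<theta> z - \<theta> t)"
    using MVT2[of t "t + d/2" h "\<lambda>s. sin (\<theta> s - \<theta> t)"] \<open>d > 0\<close> dh by auto
  have "sin (\<theta> z - \<theta> t) < 0" using d[of "z - t"] z \<open>d > 0\<close> by simp
  then have "(t + d/2 - t) * sin (\<theta> z - \<theta> t) < 0" using \<open>d > 0\<close> by (intro mult_pos_neg) auto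
  then have "h (t + d/2) < h t" using z(3) by linarith
  moreover have "h t = 0" by (simp add: h_def)
  moreover have "h (t + d/2) \<ge> 0" unfolding h_def by (rule support)
  ultimately show False by simp
qed

lemma \<theta>_mono: "s \<le> t \<Longrightarrow> \<theta> s \<le> \<theta> t"
  by (rule DERIV_nonneg_imp_nondecreasing) (use d\<theta> k_nonneg in auto)

lemma \<theta>_cont: "continuous_on A \<theta>"
  using d\<theta> by (meson DERIV_isCont continuous_at_imp_continuous_on)

text \<open>As \<open>s\<close> passes \<open>a\<close>, the supporting line at \<open>s\<close> would otherwise sweep across the point at \<open>b\<close>,
  which lies on the supporting line at \<open>a\<close>.\<close>

lemma tangent_direction_once:
  assumes "k a > 0" and b: "a < b" "b < a + 2*pi" and th: "\<theta> b = \<theta> a + 2*pi"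
  shows False
proof -
  define h where "h s = cos (\<theta> s) * (y b - y s) - sin (\<theta> s) * (x b - x s)" for s
  have dh: "(h has_real_derivative - k a * (cos (\<theta> a) * (x b - x a) + sin (\<theta> a) * (y b - y a))) (at a)"
    unfolding h_def by (rule derivative_eq_intros dx dy d\<theta> refl)+ (simp add: algebra_simps)
  have "cos (\<theta> b) = cos (\<theta> a)" "sin (\<theta> b) = sin (\<theta> a)" by (simp_all add: th)
  \<comment> \<open>The tangent lines at \<open>a\<close> and \<open>b\<close> have the same
    direction and each point lies weakly to the left of the other's line, so the lines
    coincide.\<close>
  then have ha: "h a = 0"
    using support[of a b] support[of b a] by (simp add: h_def algebra_simps)
  have "h s \<ge> 0" for s unfolding h_def by (rule support)
  \<comment> \<open>The height \<open>h\<close> of the point at \<open>b\<close> above the moving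
    tangent line is minimal at \<open>a\<close>, so its derivative is zero there. With
    \<open>k a > 0\<close> the tangential component of the difference vanishes as well, and the two
    points coincide.\<close>
  then have "- k a * (cos (\<theta> a) * (x b - x a) + sin (\<theta> a) * (y b - y a)) = 0"
    by (intro DERIV_local_min[OF dh zero_less_one]) (simp add: ha)
  then have t0: "cos (\<theta> a) * (x b - x a) + sin (\<theta> a) * (y b - y a) = 0" using \<open>k a > 0\<close> by simp
  have n0: "cos (\<theta> a) * (y b - y a) - sin (\<theta> a) * (x b - x a) = 0" using ha by (simp add: h_def)
  have "(x b - x a)\<^sup>2 + (y b - y a)\<^sup>2 =
    (cos (\<theta> a) * (x b - x a) + sin (\<theta> a) * (y b - y a))\<^sup>2 +
    (cos (\<theta> a) * (y b - y a) - sin (\<theta> a) * (x b - x a))\<^sup>2"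
    using sin_cos_squared_add[of "\<theta> a"] by algebra
  then have "x a = x b" "y a = y b" unfolding t0 n0 by (auto simp: sum_power2_eq_zero_iff)
  then show False using simple b by blast
qed

text \<open>The tangent closes up, so the turning is a multiple \<open>n\<close> of 2 pi. A curve
  with \<open>n = 0\<close> runs straight and cannot close; for \<open>n \<ge> 2\<close> some
  tangent direction recurs within a period.\<close>

lemma \<theta>_turn: "\<theta> (t + 2*pi) = \<theta> t + 2*pi"
proof -
  have per: "f' (t + 2*pi) = f' t"
    if "\<And>t. (f has_real_derivative f' t) (at t)" "\<And>t. f (t + 2*pi) = f t" for f f' :: "real \<Rightarrow> real"
  proof -
    have "((\<lambda>t. f (t + 2*pi)) has_real_derivative f' (t + 2*pi)) (at t)"
      using that(1)[of "t + 2*pi"] by (simp add: DERIV_shift)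
    then show ?thesis unfolding that(2) using DERIV_unique that(1) by blast
  qed
  obtain n :: int where n: "\<theta> (t + 2*pi) = \<theta> t + 2 * pi * n"
    using sin_cos_eq_iff[of "\<theta> (t + 2*pi)" "\<theta> t"] per[OF dx x_periodic] per[OF dy y_periodic] by auto
  have "n \<ge> 0" using \<theta>_mono[of t "t + 2*pi"] unfolding n by (simp add: zero_le_mult_iff linorder_not_le[THEN iffD2, OF pi_gt_zero])
  moreover have "n \<noteq> 0"
  proof
    assume "n = 0"
    then have const: "\<theta> s = \<theta> t" if "t \<le> s" "s \<le> t + 2*pi" for s
      using \<theta>_mono[OF that(1)] \<theta>_mono[OF that(2)] n by simp
    define u where "u s = cos (\<theta> t) * x s + sin (\<theta> t) * y s" for s
    have du: "(u has_real_derivative cos (\<theta> t - \<theta> s)) (at s)" for s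
      unfolding u_def cos_diff by (rule derivative_eq_intros dx dy refl)+ simp
    obtain z where "t < z" "z < t + 2*pi" "u (t + 2*pi) - u t = (t + 2*pi - t) * cos (\<theta> t - \<theta> z)"
      using MVT2[of t "t + 2*pi" u "\<lambda>s. cos (\<theta> t - \<theta> s)"] du by auto
    then show False using const[of z] by (simp add: u_def x_periodic y_periodic)
  qed
  moreover have "\<not> n \<ge> 2"
  proof
    assume "n \<ge> 2"
    then have "2 * pi * 2 \<le> 2 * pi * real_of_int n" by (intro mult_left_mono) auto
    then have big: "\<theta> t + 2*pi + 2*pi \<le> \<theta> (t + 2*pi)" unfolding n by simp
    \<comment> \<open>The point \<open>a\<close> with positive curvature is taken within the first
      full turn, so that a second full turn leaves room for the angle
      \<open>\<theta> a + 2*pi\<close> before the period ends.\<close>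
    then obtain t1 where t1: "t \<le> t1" "t1 \<le> t + 2*pi" "\<theta> t1 = \<theta> t + 2*pi"
      using IVT'[of \<theta> t "\<theta> t + 2*pi" "t + 2*pi"] \<theta>_cont by auto
    have "t \<noteq> t1" using t1(3) by auto
    then obtain a where a: "t < a" "a < t1" "\<theta> t1 - \<theta> t = (t1 - t) * k a"
      using MVT2[of t t1 \<theta> k] d\<theta> t1 by auto
    have "(t1 - t) * k a = 2*pi" using a(3) t1(3) by linarith
    then have "(t1 - t) * k a > 0" using pi_gt_zero by linarith
    then have "k a > 0" using a by (simp add: zero_less_mult_iff)
    have "\<theta> a + 2*pi \<le> \<theta> (t + 2*pi)" using big t1 \<theta>_mono[of a t1] a by simp
    then obtain b where b: "a \<le> b" "b \<le> t + 2*pi" "\<theta> b = \<theta> a + 2*pi"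
      using IVT'[of \<theta> a "\<theta> a + 2*pi" "t + 2*pi"] \<theta>_cont a t1 by auto
    have "a \<noteq> b" using b(3) by auto
    then show False using tangent_direction_once[OF \<open>k a > 0\<close>, of b] a b by auto
  qed
  ultimately have "n = 1" by linarith
  then show ?thesis using n by simp
qed

end

lemma six_extrema_bicycle:
  assumes "supported_curve x y \<theta> k" and "continuous_on UNIV k" and "0 < \<rho>" "\<rho> < 1"
    and chord: "\<And>t. (x (t + 2*pi*\<rho>) - x t)\<^sup>2 + (y (t + 2*pi*\<rho>) - y t)\<^sup>2 = l\<^sup>2" and "l \<ge> 0"
  shows "infinite {t \<in> {0..<2*pi}. local_extr k t} \<or> card {t \<in> {0..<2*pi}. local_extr k t} \<ge> 6"
proof -
  interpret supported_curve x y \<theta> k by fact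
  have \<rho>: "0 < 2*pi*\<rho>" "2*pi*\<rho> < 2*pi" using assms by auto
  have "l \<noteq> 0"
  proof
    assume "l = 0"
    then have "x (0 + 2*pi*\<rho>) = x 0" "y (0 + 2*pi*\<rho>) = y 0"
      using chord[of 0] by (auto simp: sum_power2_eq_zero_iff)
    then show False using simple[of 0 "2*pi*\<rho>"] \<rho> by auto
  qed
  then interpret bicycle x y \<theta> k "2*pi*\<rho>" l
    using assms \<rho> by unfold_locales (auto intro: dx dy d\<theta> k_nonneg x_periodic y_periodic \<theta>_turn)
  show ?thesis by (rule six_extrema)
qed

section \<open>Tangent angle and supporting lines of a convex curve\<close>

lemma angle_function:
  fixes u v u' v' :: "real \<Rightarrow> real"
  assumes du: "\<And>t. (u has_real_derivative u' t) (at t)" and dv: "\<And>t. (v has_real_derivative v' t) (at t)"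
    and unit: "\<And>t. (u t)\<^sup>2 + (v t)\<^sup>2 = 1"
    and cont: "continuous_on UNIV (\<lambda>t. u t * v' t - v t * u' t)"
  obtains \<theta> where "\<And>t. u t = cos (\<theta> t)" "\<And>t. v t = sin (\<theta> t)"
    and "\<And>t. (\<theta> has_real_derivative u t * v' t - v t * u' t) (at t)"
proof -
  define k where "k t = u t * v' t - v t * u' t" for t
  have "continuous_on UNIV k" using cont by (simp add: k_def[abs_def])
  then have "isCont k t" for t by (simp add: continuous_on_eq_continuous_at)
  then obtain F where F: "\<And>t. (F has_real_derivative k t) (at t)"
    using einterval_antiderivative[of "-\<infinity>" "\<infinity>" k]
    by (auto simp: has_real_derivative_iff_has_vector_derivative)
  obtain \<theta>0 where \<theta>0: "u 0 = cos \<theta>0" "v 0 = sin \<theta>0" by (rule sincos_total_2pi[OF unit[of 0]])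
  define \<theta> where "\<theta> t = F t - F 0 + \<theta>0" for t
  have d\<theta>: "(\<theta> has_real_derivative k t) (at t)" for t
    unfolding \<theta>_def by (rule derivative_eq_intros F refl)+ simp
  have perp: "u t * u' t + v t * v' t = 0" for t
  proof -
    have "((\<lambda>t. (u t)\<^sup>2 + (v t)\<^sup>2) has_real_derivative 2 * (u t * u' t + v t * v' t)) (at t)"
      by (rule derivative_eq_intros du dv refl)+ (simp add: algebra_simps)
    then show ?thesis unfolding unit using DERIV_unique[OF _ DERIV_const] by fastforce
  qed
  \<comment> \<open>The derivative of a unit vector is orthogonal to it, hence \<open>k\<close>
    times the vector rotated by a right angle.\<close>
  have rot: "u' t = - k t * v t" "v' t = k t * u t" for t
  proof -
    have "u' t * ((u t)\<^sup>2 + (v t)\<^sup>2) = - k t * v t" using perp[of t] unfolding k_def by algebra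
    then show "u' t = - k t * v t" unfolding unit by simp
    have "v' t * ((u t)\<^sup>2 + (v t)\<^sup>2) = k t * u t" using perp[of t] unfolding k_def by algebra
    then show "v' t = k t * u t" unfolding unit by simp
  qed
  \<comment> \<open>\<open>w\<close> is the inner product of \<open>(u, v)\<close> with the unit
    vector of angle \<open>\<theta>\<close>. Both rotate at speed \<open>k\<close> and agree at 0,
    so \<open>w\<close> stays 1, which forces two unit vectors to be equal.\<close>
  define w where "w t = u t * cos (\<theta> t) + v t * sin (\<theta> t)" for t
  have "(w has_real_derivative 0) (at t)" for t
    unfolding w_def by (rule derivative_eq_intros du dv d\<theta> refl)+ (simp add: rot algebra_simps)
  then have "w t = w 0" for t by (intro DERIV_isconst_all) blast
  moreover have "w 0 = 1" using \<theta>0 by (simp add: w_def \<theta>_def flip: power2_eq_square)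
  ultimately have w1: "u t * cos (\<theta> t) + v t * sin (\<theta> t) = 1" for t unfolding w_def by simp
  have eq: "u t = cos (\<theta> t) \<and> v t = sin (\<theta> t)" for t
  proof -
    have "(u t - cos (\<theta> t))\<^sup>2 + (v t - sin (\<theta> t))\<^sup>2 =
      ((u t)\<^sup>2 + (v t)\<^sup>2) + ((sin (\<theta> t))\<^sup>2 + (cos (\<theta> t))\<^sup>2) - 2 * (u t * cos (\<theta> t) + v t * sin (\<theta> t))"
      by (simp add: power2_eq_square algebra_simps)
    then show ?thesis unfolding w1 unit sin_cos_squared_add by (simp add: sum_power2_eq_zero_iff)
  qed
  show ?thesis using that[of \<theta>] eq d\<theta> unfolding k_def by blast
qed

text \<open>Each tangent line supports \<open>K\<close> and leaves a fixed interior point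
  \<open>z\<close> strictly on one side. That side is the sign of a continuous function of
  \<open>t\<close> without zeros, so it never changes.\<close>

lemma convex_curve_one_sided:
  fixes \<gamma> :: "real \<Rightarrow> real^2"
  assumes dx: "\<And>t. ((\<lambda>t. \<gamma> t $ 1) has_real_derivative cos (\<theta> t)) (at t)"
    and dy: "\<And>t. ((\<lambda>t. \<gamma> t $ 2) has_real_derivative sin (\<theta> t)) (at t)"
    and cont\<theta>: "continuous_on UNIV \<theta>"
    and per: "\<And>t. \<gamma> (t + 2*pi) = \<gamma> t"
    and K: "compact K" "convex K" "range \<gamma> = frontier K"
  shows "(\<forall>s t. cos (\<theta> t) * (\<gamma> s $ 2 - \<gamma> t $ 2) - sin (\<theta> t) * (\<gamma> s $ 1 - \<gamma> t $ 1) \<ge> 0) \<or>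
         (\<forall>s t. cos (\<theta> t) * (\<gamma> s $ 2 - \<gamma> t $ 2) - sin (\<theta> t) * (\<gamma> s $ 1 - \<gamma> t $ 1) \<le> 0)"
proof -
  have inn: "v \<bullet> w = v $ 1 * w $ 1 + v $ 2 * w $ 2" for v w :: "real^2"
    by (simp add: inner_vec_def sum_2)
  have inK: "\<gamma> t \<in> K" for t
    using K compact_imp_closed frontier_subset_closed by blast
  have d\<gamma>: "((\<lambda>t. v \<bullet> \<gamma> t) has_real_derivative v $ 1 * cos (\<theta> t) + v $ 2 * sin (\<theta> t)) (at t)" for v t
    unfolding inn by (rule derivative_eq_intros dx dy refl)+ simp
  \<comment> \<open>Otherwise the curve lies on a line with normal \<open>a\<close>. By the mean
    value theorem over a period, the coordinate \<open>u\<close> along the line has a critical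
    point; the tangent there would be orthogonal to the line as well as along it.\<close>
  have "interior K \<noteq> {}"
  proof
    assume "interior K = {}"
    then obtain a b where "a \<noteq> 0" and ab: "K \<subseteq> {z. a \<bullet> z = b}"
      using empty_interior_subset_hyperplane[OF \<open>convex K\<close>] by blast
    then have eq: "a \<bullet> \<gamma> t = b" for t using inK by auto
    have a0: "a $ 1 * cos (\<theta> t) + a $ 2 * sin (\<theta> t) = 0" for t
      using d\<gamma>[of a t] unfolding eq by (rule DERIV_unique[OF _ DERIV_const])
    define u where "u t = a $ 1 * \<gamma> t $ 2 - a $ 2 * \<gamma> t $ 1" for t
    have du: "(u has_real_derivative a $ 1 * sin (\<theta> t) - a $ 2 * cos (\<theta> t)) (at t)" for t
      unfolding u_def by (rule derivative_eq_intros dx dy refl)+ simp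
    obtain z where z: "u (0 + 2*pi) - u 0 = (2*pi - 0) * (a $ 1 * sin (\<theta> z) - a $ 2 * cos (\<theta> z))"
      using MVT2[of 0 "2*pi" u "\<lambda>t. a $ 1 * sin (\<theta> t) - a $ 2 * cos (\<theta> t)"] du by auto
    then have u0: "a $ 1 * sin (\<theta> z) - a $ 2 * cos (\<theta> z) = 0"
      unfolding u_def per by simp
    have "(a $ 1)\<^sup>2 + (a $ 2)\<^sup>2 = (a $ 1 * cos (\<theta> z) + a $ 2 * sin (\<theta> z))\<^sup>2 + (a $ 1 * sin (\<theta> z) - a $ 2 * cos (\<theta> z))\<^sup>2"
      using sin_cos_squared_add[of "\<theta> z"] by algebra
    then have "a $ 1 = 0" "a $ 2 = 0" unfolding a0 u0 by (auto simp: sum_power2_eq_zero_iff)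
    then show False using \<open>a \<noteq> 0\<close> by (simp add: vec_eq_iff forall_2)
  qed
  then obtain z where z: "z \<in> interior K" by blast
  define N where "N t p = cos (\<theta> t) * (p $ 2 - \<gamma> t $ 2) - sin (\<theta> t) * (p $ 1 - \<gamma> t $ 1)" for t and p :: "real^2"
  have sup: "\<exists>\<mu>. (\<forall>p\<in>K. \<mu> * N t p \<ge> 0) \<and> \<mu> * N t z > 0" for t
  proof -
    have "\<gamma> t \<in> frontier K" using K(3) by blast
    then have "\<gamma> t \<notin> rel_interior K"
      using rel_interior_nonempty_interior[OF \<open>interior K \<noteq> {}\<close>] by (simp add: frontier_def)
    then obtain a where "a \<noteq> 0" and a: "\<And>p. p \<in> K \<Longrightarrow> a \<bullet> \<gamma> t \<le> a \<bullet> p"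
      "\<And>p. p \<in> rel_interior K \<Longrightarrow> a \<bullet> \<gamma> t < a \<bullet> p"
      using supporting_hyperplane_rel_boundary[OF \<open>convex K\<close> inK[of t]] by blast
    \<comment> \<open>The function \<open>a \<bullet> \<gamma>\<close> is minimal at
      \<open>t\<close>, so \<open>a\<close> is orthogonal to the tangent and equals
      \<open>\<mu>\<close> times the left unit normal. Thus the supporting line is the tangent
      line.\<close>
    have a0: "a $ 1 * cos (\<theta> t) + a $ 2 * sin (\<theta> t) = 0"
      using a(1) inK by (intro DERIV_local_min[OF d\<gamma>[of a t], of 1]) auto
    define \<mu> where "\<mu> = a $ 2 * cos (\<theta> t) - a $ 1 * sin (\<theta> t)"
    have "a $ 1 * ((sin (\<theta> t))\<^sup>2 + (cos (\<theta> t))\<^sup>2) = - \<mu> * sin (\<theta> t)"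
      unfolding \<mu>_def using a0 by algebra
    then have a1: "a $ 1 = - \<mu> * sin (\<theta> t)" by simp
    have "a $ 2 * ((sin (\<theta> t))\<^sup>2 + (cos (\<theta> t))\<^sup>2) = \<mu> * cos (\<theta> t)"
      unfolding \<mu>_def using a0 by algebra
    then have a2: "a $ 2 = \<mu> * cos (\<theta> t)" by simp
    have "\<mu> * N t p = a \<bullet> p - a \<bullet> \<gamma> t" for p
      unfolding inn a1 a2 N_def by (simp add: algebra_simps)
    then show ?thesis
      using a z rel_interior_nonempty_interior[OF \<open>interior K \<noteq> {}\<close>]
      by (intro exI[of _ \<mu>]) auto
  qed
  have nz: "N t z \<noteq> 0" for t using sup[of t] by auto
  have contx: "continuous_on UNIV (\<lambda>t. \<gamma> t $ 1)" and conty: "continuous_on UNIV (\<lambda>t. \<gamma> t $ 2)"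
    using dx dy by (meson DERIV_isCont continuous_at_imp_continuous_on)+
  have "continuous_on UNIV (\<lambda>t. N t z)"
    unfolding N_def
    by (intro continuous_on_diff continuous_on_mult continuous_on_cos continuous_on_sin
        continuous_on_const cont\<theta> contx conty)
  then have conn: "connected (range (\<lambda>t. N t z))" by (rule connected_continuous_image) simp
  have "False" if "N s z < 0" "N t z > 0" for s t
  proof -
    have "0 \<in> range (\<lambda>t. N t z)"
      by (rule connectedD_interval[OF conn rangeI[of _ s] rangeI[of _ t]]) (use that in simp_all)
    then show False using nz by auto
  qed
  then have "(\<forall>t. N t z > 0) \<or> (\<forall>t. N t z < 0)"
    using nz by (meson linorder_neqE_linordered_idom)
  then show ?thesis
  proof
    assume pos: "\<forall>t. N t z > 0"
    have "N t (\<gamma> s) \<ge> 0" for s t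
    proof -
      obtain \<mu> where m: "\<forall>p\<in>K. \<mu> * N t p \<ge> 0" "\<mu> * N t z > 0" using sup by blast
      have "\<mu> > 0" using m(2) spec[OF pos, of t] by (rule zero_less_mult_pos2)
      moreover have "0 \<le> \<mu> * N t (\<gamma> s)" using m(1) inK by blast
      ultimately show ?thesis by (simp add: zero_le_mult_iff)
    qed
    then show ?thesis unfolding N_def by blast
  next
    assume neg: "\<forall>t. N t z < 0"
    have "N t (\<gamma> s) \<le> 0" for s t
    proof -
      obtain \<mu> where m: "\<forall>p\<in>K. \<mu> * N t p \<ge> 0" "\<mu> * N t z > 0" using sup by blast
      have "\<mu> < 0" using m(2) spec[OF neg, of t] by (simp add: zero_less_mult_iff)
      moreover have "0 \<le> \<mu> * N t (\<gamma> s)" using m(1) inK by blast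
      ultimately show ?thesis by (simp add: zero_le_mult_iff)
    qed
    then show ?thesis unfolding N_def by blast
  qed
qed

section \<open>Reduction of convex bicycle curves to supported curves\<close>

theorem theorem4:
  fixes \<gamma> :: "real \<Rightarrow> real^2"
  assumes "smooth_closed_arclength_curve \<gamma>"
    and "convex_curve \<gamma>"
    and "bicycle_curve \<gamma>"
  shows "infinite (vertices \<gamma>) \<or> card (vertices \<gamma>) \<ge> 6"
proof -
  have sm: "\<And>n t. vderiv n \<gamma> differentiable (at t)" and per: "\<And>t. \<gamma> (t + 2*pi) = \<gamma> t"
    and unit: "\<And>t. norm (vderiv 1 \<gamma> t) = 1"
    using assms(1) unfolding smooth_closed_arclength_curve_def smooth_def by auto
  obtain K where inj: "inj_on \<gamma> {0..<2*pi}" and K: "compact K" "convex K" "range \<gamma> = frontier K"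
    using assms(2) unfolding convex_curve_def by blast
  obtain \<rho> l where \<rho>: "0 < \<rho>" "\<rho> < 1" and l: "\<And>t. dist (\<gamma> (t + 2*pi*\<rho>)) (\<gamma> t) = l"
    using assms(3) unfolding bicycle_curve_def by blast
  have D: "((\<lambda>t. vderiv n \<gamma> t $ i) has_real_derivative vderiv (Suc n) \<gamma> t $ i) (at t)" for n i t
  proof -
    have "(vderiv n \<gamma> has_vector_derivative vderiv (Suc n) \<gamma> t) (at t)"
      using sm[of n t] by (simp add: vderiv_def vector_derivative_works)
    then show ?thesis
      unfolding has_real_derivative_iff_has_vector_derivative
      by (rule bounded_linear.has_vector_derivative[OF bounded_linear_vec_nth])
  qed
  have nrm: "(norm v)\<^sup>2 = (v $ 1)\<^sup>2 + (v $ 2)\<^sup>2" for v :: "real^2"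
    unfolding power2_norm_eq_inner by (simp add: inner_vec_def sum_2 power2_eq_square)
  have D0: "((\<lambda>t. \<gamma> t $ i) has_real_derivative vderiv 1 \<gamma> t $ i) (at t)" for i t
    using D[of 0 i t] by (simp add: vderiv_def)
  have D1: "((\<lambda>t. vderiv 1 \<gamma> t $ i) has_real_derivative vderiv 2 \<gamma> t $ i) (at t)" for i t
    using D[of 1 i t] by (simp add: numeral_2_eq_2)
  have cont: "continuous_on UNIV (\<lambda>t. vderiv n \<gamma> t $ i)" for n i
    using D by (meson DERIV_isCont continuous_at_imp_continuous_on)
  have cont_k: "continuous_on UNIV (curvature \<gamma>)"
    unfolding curvature_def by (intro continuous_on_diff continuous_on_mult cont)
  have unit2: "(vderiv 1 \<gamma> t $ 1)\<^sup>2 + (vderiv 1 \<gamma> t $ 2)\<^sup>2 = 1" for t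
    using nrm[of "vderiv 1 \<gamma> t"] unit[of t] by simp
  obtain \<theta> where \<theta>: "\<And>t. vderiv 1 \<gamma> t $ 1 = cos (\<theta> t)" "\<And>t. vderiv 1 \<gamma> t $ 2 = sin (\<theta> t)"
    and d\<theta>: "\<And>t. (\<theta> has_real_derivative curvature \<gamma> t) (at t)"
    by (rule angle_function[OF D1[of 1] D1[of 2] unit2 cont_k[unfolded curvature_def[abs_def]],
      folded curvature_def]) blast
  have cont\<theta>: "continuous_on UNIV \<theta>"
    using d\<theta> by (meson DERIV_isCont continuous_at_imp_continuous_on)
  have dx: "((\<lambda>t. \<gamma> t $ 1) has_real_derivative cos (\<theta> t)) (at t)"
    and dy: "((\<lambda>t. \<gamma> t $ 2) has_real_derivative sin (\<theta> t)) (at t)" for t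
    using D0[of 1 t] D0[of 2 t] by (simp_all only: \<theta>)
  have simple: "\<gamma> a \<noteq> \<gamma> b" if "a < b" "b < a + 2*pi" for a b
  proof
    assume "\<gamma> a = \<gamma> b"
    then have "\<gamma> (wrap a) = \<gamma> (wrap b)" using periodic_wrap[of \<gamma>, OF per] by simp
    then have "wrap a = wrap b" using inj_onD[OF inj _ wrap_range wrap_range] by blast
    then have "a = b" by (rule inj_onD[OF inj_on_wrap[of a]]) (use that in simp_all)
    then show False using that by simp
  qed
  have simple': "\<gamma> a $ 2 \<noteq> \<gamma> b $ 2" if "a < b" "b < a + 2*pi" "\<gamma> a $ 1 = \<gamma> b $ 1" for a b
    using simple[OF that(1,2)] that(3) by (auto simp: vec_eq_iff forall_2)
  have chord: "(\<gamma> (t + 2*pi*\<rho>) $ 1 - \<gamma> t $ 1)\<^sup>2 + (\<gamma> (t + 2*pi*\<rho>) $ 2 - \<gamma> t $ 2)\<^sup>2 = l\<^sup>2" for t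
    using nrm[of "\<gamma> (t + 2*pi*\<rho>) - \<gamma> t"] l[of t] by (simp add: dist_norm)
  have "l \<ge> 0" using l[of 0] by auto
  have vert: "vertices \<gamma> = {t \<in> {0..<2*pi}. local_extr (curvature \<gamma>) t}"
    by (simp add: vertices_def is_vertex_def local_max_def)
  consider
      "\<forall>s t. cos (\<theta> t) * (\<gamma> s $ 2 - \<gamma> t $ 2) - sin (\<theta> t) * (\<gamma> s $ 1 - \<gamma> t $ 1) \<ge> 0"
    | "\<forall>s t. cos (\<theta> t) * (\<gamma> s $ 2 - \<gamma> t $ 2) - sin (\<theta> t) * (\<gamma> s $ 1 - \<gamma> t $ 1) \<le> 0"
    using convex_curve_one_sided[OF dx dy cont\<theta> per K] by (rule disjE)
  then show ?thesis
  proof cases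
    case 1
    have sc: "supported_curve (\<lambda>t. \<gamma> t $ 1) (\<lambda>t. \<gamma> t $ 2) \<theta> (curvature \<gamma>)"
    proof
      show "\<gamma> a $ 2 \<noteq> \<gamma> b $ 2" if "a < b" "b < a + 2*pi" "\<gamma> a $ 1 = \<gamma> b $ 1" for a b
        using that by (rule simple')
    qed (use dx dy d\<theta> 1 in \<open>simp_all add: per\<close>)
    show ?thesis
      unfolding vert by (rule six_extrema_bicycle[OF sc cont_k \<rho> chord \<open>l \<ge> 0\<close>])
  next
    case 2
    \<comment> \<open>A clockwise curve is reflected in the first axis. This negates the tangent
      angle and the curvature and only swaps maxima with minima, leaving the set of vertices
      unchanged.\<close>
    have sc: "supported_curve (\<lambda>t. \<gamma> t $ 1) (\<lambda>t. - \<gamma> t $ 2) (\<lambda>t. - \<theta> t) (\<lambda>t. - curvature \<gamma> t)"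
    proof
      show "((\<lambda>t. \<gamma> t $ 1) has_real_derivative cos (- \<theta> t)) (at t)" for t using dx by simp
      show "((\<lambda>t. - \<gamma> t $ 2) has_real_derivative sin (- \<theta> t)) (at t)" for t
        using DERIV_minus[OF dy] by simp
      show "((\<lambda>t. - \<theta> t) has_real_derivative - curvature \<gamma> t) (at t)" for t
        by (rule DERIV_minus[OF d\<theta>])
      show "- \<gamma> a $ 2 \<noteq> - \<gamma> b $ 2" if "a < b" "b < a + 2*pi" "\<gamma> a $ 1 = \<gamma> b $ 1" for a b
        using simple'[OF that] by simp
      show "0 \<le> cos (- \<theta> t) * (- \<gamma> s $ 2 - - \<gamma> t $ 2) - sin (- \<theta> t) * (\<gamma> s $ 1 - \<gamma> t $ 1)" for s t
        using 2[rule_format, of t s] by (simp add: algebra_simps)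
    qed (simp_all add: per)
    have chord': "(\<gamma> (t + 2*pi*\<rho>) $ 1 - \<gamma> t $ 1)\<^sup>2 + (- \<gamma> (t + 2*pi*\<rho>) $ 2 - - \<gamma> t $ 2)\<^sup>2 = l\<^sup>2" for t
      using chord[of t] by (simp add: power2_commute)
    have cont': "continuous_on UNIV (\<lambda>t. - curvature \<gamma> t)" using cont_k by (intro continuous_intros)
    have "infinite {t \<in> {0..<2*pi}. local_extr (\<lambda>t. - curvature \<gamma> t) t} \<or>
        card {t \<in> {0..<2*pi}. local_extr (\<lambda>t. - curvature \<gamma> t) t} \<ge> 6"
      by (rule six_extrema_bicycle[OF sc cont' \<rho> chord' \<open>l \<ge> 0\<close>])
    then show ?thesis unfolding vert by (simp add: disj_commute)
  qed
qed

end
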